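(* Let $k$ be an algebraically closed field with $\operatorname{char}(k)\neq 2$ and let $n\ge 1$. The sets $\mathrm{Salg}^i_n$ ($1\le i\le n$) are closed subsets of $\mathrm{Salg}_n$ in each of the following situations: (a) $\operatorname{char}(k)=p>0$ and $n\le 2p$; (b) $\operatorname{char}(k)=0$ (with no restriction on $n$); (c) $n\le 6$ (for any algebraically closed field $k$ with $\operatorname{char}(k)\ne 2$).
   Context: A superalgebra is a $\mathbb{Z}_2$-graded associative unital algebra $A=A_0\oplus A_1$ over $k$; equivalently an algebra $A$ with an algebra automorphism $\sigma$ satisfying $\sigma^2=\mathrm{id}$ ($\sigma=1$ on $A_0$, $\sigma=-1$ on $A_1$). $\mathrm{Salg}_n\subseteq\mathbb{A}^{n^3+n^2}$ is the set of all $(\alpha^h_{ij},\gamma^j_i)_{1\le i,j,h\le n}$ such that $e_ie_j=\sum_h\alpha^h_{ij}e_h$ defines an associative algebra structure on $k^n$ (standard basis $e_1,\dots,e_n$) with identity $e_1$, and $\sigma(e_i)=\sum_j\gamma^j_ie_j$ defines an algebra automorphism with $\sigma^2=\mathrm{id}$. It is a Zariski closed subset of $\mathbb{A}^{n^3+n^2}$ and carries the Zariski topology. $\mathrm{Salg}^i_n$ is the subset of those points whose superalgebra $A$ satisfies $\dim A_0=i$. *)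

theory Defs
  imports
    "HOL-Analysis.Abstract_Topology"
    "HOL-Library.FuncSet"
    "HOL-Algebra.QuotRing"
    "Jordan_Normal_Form.VS_Connect"
begin

section \<open>Affine space with the Zariski topology\<close>

definition affine_space :: "'i set \<Rightarrow> ('i \<Rightarrow> 'a) set" where
  "affine_space I = (\<Pi>\<^sub>E i\<in>I. UNIV)"

text \<open>
  Polynomial functions stand in for multivariate polynomials: a zero locus depends only on the
  values of the polynomials.
\<close>

inductive_set poly_funs :: "'i set \<Rightarrow> (('i \<Rightarrow> 'a::comm_ring_1) \<Rightarrow> 'a) set"
  for I :: "'i set" where
  const: "(\<lambda>x. c) \<in> poly_funs I"
| coord: "i \<in> I \<Longrightarrow> (\<lambda>x. x i) \<in> poly_funs I"
| add: "f \<in> poly_funs I \<Longrightarrow> g \<in> poly_funs I \<Longrightarrow> (\<lambda>x. f x + g x) \<in> poly_funs I"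
| mult: "f \<in> poly_funs I \<Longrightarrow> g \<in> poly_funs I \<Longrightarrow> (\<lambda>x. f x * g x) \<in> poly_funs I"

definition zero_locus :: "'i set \<Rightarrow> (('i \<Rightarrow> 'a::comm_ring_1) \<Rightarrow> 'a) set \<Rightarrow> ('i \<Rightarrow> 'a) set" where
  "zero_locus I F = {x \<in> affine_space I. \<forall>f\<in>F. f x = 0}"

definition zariski_open :: "'i set \<Rightarrow> ('i \<Rightarrow> 'a::comm_ring_1) set \<Rightarrow> bool" where
  "zariski_open I U \<longleftrightarrow> (\<exists>F \<subseteq> poly_funs I. U = affine_space I - zero_locus I F)"

definition zariski :: "'i set \<Rightarrow> ('i \<Rightarrow> 'a::idom) topology" where
  "zariski I = topology (zariski_open I)"

text \<open>
  \<^const>\<open>topology\<close> is only meaningful on predicates satisfying \<^const>\<open>istopology\<close>, hence the following lemmas.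
\<close>

lemma istopology_zariski_open: "istopology (zariski_open I :: ('i \<Rightarrow> 'a::idom) set \<Rightarrow> bool)"
  unfolding istopology_def
proof (intro conjI allI impI)
  fix S T :: "('i \<Rightarrow> 'a) set"
  assume "zariski_open I S" "zariski_open I T"
  then obtain F G where FG: "F \<subseteq> poly_funs I" "G \<subseteq> poly_funs I"
    "S = affine_space I - zero_locus I F" "T = affine_space I - zero_locus I G"
    unfolding zariski_open_def by blast
  define H where "H = {(\<lambda>x. f x * g x) | f g. f \<in> F \<and> g \<in> G}"
  have "H \<subseteq> poly_funs I"
    using FG(1,2) by (auto simp: H_def intro!: poly_funs.mult)
  moreover have "S \<inter> T = affine_space I - zero_locus I H"
    unfolding FG(3,4) zero_locus_def H_def by fastforce
  ultimately show "zariski_open I (S \<inter> T)"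
    unfolding zariski_open_def by blast
next
  fix \<K> :: "('i \<Rightarrow> 'a) set set"
  assume "\<forall>K\<in>\<K>. zariski_open I K"
  then obtain F where F: "\<And>K. K \<in> \<K> \<Longrightarrow> F K \<subseteq> poly_funs I \<and> K = affine_space I - zero_locus I (F K)"
    unfolding zariski_open_def by metis
  have "(\<Union>K\<in>\<K>. F K) \<subseteq> poly_funs I"
    using F by blast
  moreover have "\<Union>\<K> = (\<Union>K\<in>\<K>. affine_space I - zero_locus I (F K))"
    using F by auto
  then have "\<Union>\<K> = affine_space I - zero_locus I (\<Union>K\<in>\<K>. F K)"
    by (auto simp: zero_locus_def)
  ultimately show "zariski_open I (\<Union>\<K>)"
    unfolding zariski_open_def by blast
qed

lemma openin_zariski: "openin (zariski I) U \<longleftrightarrow> zariski_open I U"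
  unfolding zariski_def by (simp add: istopology_zariski_open)

lemma topspace_zariski: "topspace (zariski I :: ('i \<Rightarrow> 'a::idom) topology) = affine_space I"
proof -
  have "zariski_open I (affine_space I :: ('i \<Rightarrow> 'a) set)"
    unfolding zariski_open_def
    by (rule exI[of _ "{\<lambda>x. 1}"]) (auto simp: zero_locus_def intro: poly_funs.const)
  then show ?thesis
    by (auto simp: topspace_def openin_zariski zariski_open_def)
qed

lemma closedin_zariski:
  fixes C :: "('i \<Rightarrow> 'a::idom) set"
  shows "closedin (zariski I) C \<longleftrightarrow> (\<exists>F \<subseteq> poly_funs I. C = zero_locus I F)"
proof -
  have *: "zero_locus I F \<subseteq> affine_space I" for F :: "(('i \<Rightarrow> 'a) \<Rightarrow> 'a) set"
    by (auto simp: zero_locus_def)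
  then show ?thesis
    unfolding closedin_def topspace_zariski openin_zariski zariski_open_def
    by (metis * double_diff order_refl)
qed

section \<open>Superalgebras\<close>

text \<open>
  The field is a type, and \<^const>\<open>class_ring\<close> turns it into a ring record, so that a
  \<open>k\<close>-algebra is a \<open>module\<close> record which is both a vector space and a (not necessarily
  commutative) unital ring. The grading is encoded by the automorphism \<open>\<sigma>\<close>.
\<close>

definition superalgebra :: "('a::field, 'v, 'm) module_scheme \<Rightarrow> ('v \<Rightarrow> 'v) \<Rightarrow> bool" where
  "superalgebra A \<sigma> \<longleftrightarrow>
     vectorspace (class_ring :: 'a ring) A \<and> ring A \<and>
     (\<forall>c. \<forall>x\<in>carrier A. \<forall>y\<in>carrier A.
        (c \<odot>\<^bsub>A\<^esub> x) \<otimes>\<^bsub>A\<^esub> y = c \<odot>\<^bsub>A\<^esub> (x \<otimes>\<^bsub>A\<^esub> y) \<and>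
        x \<otimes>\<^bsub>A\<^esub> (c \<odot>\<^bsub>A\<^esub> y) = c \<odot>\<^bsub>A\<^esub> (x \<otimes>\<^bsub>A\<^esub> y)) \<and>
     \<sigma> \<in> ring_iso A A \<and>
     (\<forall>c. \<forall>x\<in>carrier A. \<sigma> (c \<odot>\<^bsub>A\<^esub> x) = c \<odot>\<^bsub>A\<^esub> \<sigma> x) \<and>
     (\<forall>x\<in>carrier A. \<sigma> (\<sigma> x) = x)"

definition even_part ::
  "('a::field, 'v, 'm) module_scheme \<Rightarrow> ('v \<Rightarrow> 'v) \<Rightarrow> ('a, 'v, 'm) module_scheme" where
  "even_part A \<sigma> = A\<lparr>carrier := {x \<in> carrier A. \<sigma> x = x}\<rparr>"

section \<open>The variety of superalgebra structures\<close>

text \<open>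
  \<open>Alpha i j h\<close> is the coordinate \<open>\<alpha>\<^bsup>h\<^esup>\<^bsub>ij\<^esub>\<close> and \<open>Gamma i j\<close> is the coordinate
  \<open>\<gamma>\<^bsup>j\<^esup>\<^bsub>i\<^esub>\<close>. As vectors are indexed from 0, so are the coordinates; the
  basis vector \<open>e\<^sub>1\<close> becomes \<open>unit_vec n 0\<close>.
\<close>

datatype salg_coord = Alpha nat nat nat | Gamma nat nat

definition salg_coords :: "nat \<Rightarrow> salg_coord set" where
  "salg_coords n = {Alpha i j h | i j h. i < n \<and> j < n \<and> h < n} \<union> {Gamma i j | i j. i < n \<and> j < n}"

lemma card_salg_coords: "finite (salg_coords n) \<and> card (salg_coords n) = n ^ 3 + n ^ 2"
proof -
  have eq: "salg_coords n =
      (\<lambda>(i, j, h). Alpha i j h) ` ({..<n} \<times> {..<n} \<times> {..<n}) \<union> (\<lambda>(i, j). Gamma i j) ` ({..<n} \<times> {..<n})"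
    by (auto simp: salg_coords_def image_iff)
  show ?thesis
    unfolding eq
    by (subst card_Un_disjoint)
      (auto simp: card_image inj_on_def card_cartesian_product power2_eq_square power3_eq_cube)
qed

text \<open>The product is the bilinear extension of \<open>e\<^sub>i e\<^sub>j = \<Sum>\<^sub>h \<alpha>\<^bsup>h\<^esup>\<^bsub>ij\<^esub> e\<^sub>h\<close>.\<close>

definition salg_algebra :: "nat \<Rightarrow> (salg_coord \<Rightarrow> 'a::field) \<Rightarrow> ('a, 'a vec) module" where
  "salg_algebra n x = (module_vec TYPE('a) n)
     \<lparr>mult := (\<lambda>u v. vec n (\<lambda>h. \<Sum>i<n. \<Sum>j<n. u $ i * v $ j * x (Alpha i j h))),
      one := unit_vec n 0\<rparr>"

definition salg_sigma :: "nat \<Rightarrow> (salg_coord \<Rightarrow> 'a::field) \<Rightarrow> 'a vec \<Rightarrow> 'a vec" where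
  "salg_sigma n x u = vec n (\<lambda>j. \<Sum>i<n. u $ i * x (Gamma i j))"

definition Salg :: "nat \<Rightarrow> (salg_coord \<Rightarrow> 'a::field) set" where
  "Salg n = {x \<in> affine_space (salg_coords n). superalgebra (salg_algebra n x) (salg_sigma n x)}"

definition Salg_dim :: "nat \<Rightarrow> nat \<Rightarrow> (salg_coord \<Rightarrow> 'a::field) set" where
  "Salg_dim n i = {x \<in> Salg n.
     vectorspace.dim (class_ring :: 'a ring) (even_part (salg_algebra n x) (salg_sigma n x)) = i}"

definition Salg_top :: "nat \<Rightarrow> (salg_coord \<Rightarrow> 'a::field) topology" where
  "Salg_top n = subtopology (zariski (salg_coords n)) (Salg n)"

end

theory Submission
  imports Defs "Jordan_Normal_Form.DL_Rank" "Jordan_Normal_Form.Matrix_Kernel" "Jordan_Normal_Form.Char_Poly"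
begin

text \<open>
  As 2 is invertible, \<open>k\<^sup>n\<close> is the direct sum of the eigenspaces of the involution \<open>\<sigma>\<close> for \<open>1\<close>
  and \<open>- 1\<close>. Hence \<open>dim A\<^sub>0 = i\<close> iff the characteristic polynomial of \<open>\<sigma>\<close> is
  \<open>(X - 1)\<^sup>i (X + 1)\<^bsup>n - i\<^esup>\<close>, and this is a polynomial condition on the coordinates, because the
  coefficients of the characteristic polynomial are polynomials in the matrix entries.
\<close>

section \<open>Independence of the dimension from the multiplicative fields of a module
  record\<close>

lemma vectorspace_cong:
  fixes V W :: "('a, 'v, 'm) module_scheme"
  assumes "vectorspace K V" "carrier W = carrier V" "add W = add V" "zero W = zero V"
    "module.smult W = module.smult V"
  shows "vectorspace K W"
proof -
  have am: "add_monoid W = add_monoid V"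
    using assms by simp
  show ?thesis
    using assms(1) am assms(2-)
    by (simp add: vectorspace_def module_def module_axioms_def abelian_group_def
        abelian_monoid_def abelian_group_axioms_def)
qed

text \<open>Dimension is defined through \<open>span\<close> and \<open>lincomb\<close>, which see
  only the four fields assumed equal. This allows the even part, whose record also carries the
  product and unit of the algebra, to be compared with a matrix kernel, whose record has other
  entries there.\<close>

lemma vectorspace_dim_cong:
  fixes V W :: "('a, 'v, 'm) module_scheme"
  assumes V: "vectorspace K V" and eq: "carrier W = carrier V" "add W = add V" "zero W = zero V"
    "module.smult W = module.smult V"
  shows "vectorspace.dim K W = vectorspace.dim K V"
proof -
  have am: "add_monoid W = add_monoid V"
    using eq by simp
  have W: "vectorspace K W"
    using vectorspace_cong[OF assms] .
  have fs: "finsum W = finsum V"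
    unfolding finsum_def am ..
  have "module.lincomb W = module.lincomb V"
    by (intro ext) (simp add: module.lincomb_def[OF vectorspace.axioms(1)[OF V]]
        module.lincomb_def[OF vectorspace.axioms(1)[OF W]] eq fs)
  then have "module.span K W = module.span K V"
    by (intro ext) (simp add: module.span_def[OF vectorspace.axioms(1)[OF V]]
        module.span_def[OF vectorspace.axioms(1)[OF W]])
  then show ?thesis
    by (simp add: vectorspace.dim_def[OF V] vectorspace.dim_def[OF W] eq)
qed

section \<open>Diagonalization of an involution and its characteristic polynomial\<close>

text \<open>Independence inside the kernel agrees with independence in the ambient space, so
  independent sets have at most \<open>nc\<close> elements. Hence a maximal one exists, and it is a
  basis.\<close>

lemma (in kernel) finite_basis:
  obtains B where "finite B" "Ker.basis B"
proof -
  have "\<exists>B. finite B \<and> maximal B (\<lambda>T. T \<subseteq> mat_kernel A \<and> Ker.lin_indpt T)"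
  proof (rule maximal_exists)
    show "{} \<subseteq> mat_kernel A \<and> Ker.lin_indpt {}"
      by (auto simp: Ker.lin_dep_def)
    fix T assume "T \<subseteq> mat_kernel A \<and> Ker.lin_indpt T"
    then have "T \<subseteq> carrier_vec nc" "NC.lin_indpt T"
      using lindep_same A by (auto simp: mat_kernel_def)
    then show "finite T \<and> card T \<le> nc"
      using NC.li_le_dim[of T] by (auto simp: NC.dim_is_n)
  qed
  then show ?thesis
    using that Ker.max_li_is_basis by blast
qed

text \<open>For \<open>w\<close> the image of \<open>v\<close> under an involution, the summands are
  the components of \<open>v\<close> in the eigenspaces for 1 and -1.\<close>

lemma vec_eq_half_sum_diff:
  fixes v w :: "'a::field vec"
  assumes "(2::'a) \<noteq> 0" "v \<in> carrier_vec n" "w \<in> carrier_vec n"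
  shows "v = inverse 2 \<cdot>\<^sub>v (v + w) + inverse 2 \<cdot>\<^sub>v (v - w)"
proof (rule eq_vecI)
  fix i assume "i < dim_vec (inverse 2 \<cdot>\<^sub>v (v + w) + inverse 2 \<cdot>\<^sub>v (v - w))"
  then have i: "i < n" using assms by auto
  have "v $ i = inverse 2 * (2 * v $ i)" using assms(1) by simp
  also have "\<dots> = inverse 2 * (v $ i + w $ i) + inverse 2 * (v $ i - w $ i)"
    by (simp only: distrib_left[symmetric]) simp
  finally show "v $ i = (inverse 2 \<cdot>\<^sub>v (v + w) + inverse 2 \<cdot>\<^sub>v (v - w)) $ i"
    using i assms by simp
qed (use assms in auto)

lemma mat_kernel_minus_one:
  assumes "S \<in> carrier_mat n n"
  shows "mat_kernel (S - 1\<^sub>m n) = {v \<in> carrier_vec n. S *\<^sub>v v = v}"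
proof -
  have "(S - 1\<^sub>m n) *\<^sub>v v = S *\<^sub>v v - v" if "v \<in> carrier_vec n" for v
    using that assms by (simp add: minus_mult_distrib_mat_vec)
  moreover have "S *\<^sub>v v - v = 0\<^sub>v n \<longleftrightarrow> S *\<^sub>v v = v" if "v \<in> carrier_vec n" for v
    using that assms by (auto simp: vec_eq_iff)
  ultimately show ?thesis
    using assms by (auto simp: mat_kernel_def)
qed

lemma mat_kernel_plus_one:
  assumes "S \<in> carrier_mat n n"
  shows "mat_kernel (S + 1\<^sub>m n) = {v \<in> carrier_vec n. S *\<^sub>v v = - v}"
proof -
  have "(S + 1\<^sub>m n) *\<^sub>v v = S *\<^sub>v v + v" if "v \<in> carrier_vec n" for v
    using that assms by (simp add: add_mult_distrib_mat_vec)
  moreover have "S *\<^sub>v v + v = 0\<^sub>v n \<longleftrightarrow> S *\<^sub>v v = - v" if "v \<in> carrier_vec n" for v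
    using that assms by (auto simp: vec_eq_iff eq_neg_iff_add_eq_0)
  ultimately show ?thesis
    using assms by (auto simp: mat_kernel_def)
qed

text \<open>Bases \<open>B\<close> and \<open>C\<close> of the two eigenspaces together span the
  whole space. Enlarging \<open>B\<close> by vectors of \<open>C\<close> to a maximal independent
  set gives \<open>n\<close> independent eigenvectors, of which those in \<open>B\<close> number the
  dimension of the fixed space.\<close>

lemma involution_eigenbasis:
  fixes S :: "'a::field mat"
  assumes S: "S \<in> carrier_mat n n" and two: "(2::'a) \<noteq> 0"
    and inv: "\<And>v. v \<in> carrier_vec n \<Longrightarrow> S *\<^sub>v (S *\<^sub>v v) = v"
  obtains us ws where "length us = kernel_dim (S - 1\<^sub>m n)" "length us + length ws = n"
    "set us \<subseteq> {v \<in> carrier_vec n. S *\<^sub>v v = v}" "set ws \<subseteq> {v \<in> carrier_vec n. S *\<^sub>v v = - v}"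
    "det (mat_of_cols n (us @ ws)) \<noteq> 0"
proof -
  interpret V: vec_space "TYPE('a)" n .
  interpret E: kernel n n "S - 1\<^sub>m n" by unfold_locales (use S in auto)
  interpret O: kernel n n "S + 1\<^sub>m n" by unfold_locales (use S in auto)
  obtain B where B: "finite B" "E.Ker.basis B" by (rule E.finite_basis)
  obtain C where C: "finite C" "O.Ker.basis C" by (rule O.finite_basis)
  have Bk: "B \<subseteq> mat_kernel (S - 1\<^sub>m n)" and Ck: "C \<subseteq> mat_kernel (S + 1\<^sub>m n)"
    using B C by (auto simp: E.Ker.basis_def O.Ker.basis_def)
  then have BC: "B \<union> C \<subseteq> carrier_vec n"
    using S by (auto simp: mat_kernel_def)
  have Bs: "V.span B = mat_kernel (S - 1\<^sub>m n)"
    using B(2) E.span_same[OF Bk] by (auto simp: E.Ker.basis_def)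
  have Cs: "V.span C = mat_kernel (S + 1\<^sub>m n)"
    using C(2) O.span_same[OF Ck] by (auto simp: O.Ker.basis_def)
  have Bi: "V.lin_indpt B" using B(2) E.lindep_same[OF Bk] by (auto simp: E.Ker.basis_def)
  have "carrier_vec n \<subseteq> V.span (B \<union> C)"
  proof
    fix v :: "'a vec" assume v: "v \<in> carrier_vec n"
    have Sv: "S *\<^sub>v v \<in> carrier_vec n" using S v by auto
    \<comment> \<open>These are the projections of \<open>v\<close> to the eigenspaces:
      \<open>S\<close> swaps \<open>v\<close> and \<open>S *\<^sub>v v\<close>, so it fixes their
      sum and negates their difference.\<close>
    define v1 where "v1 = inverse 2 \<cdot>\<^sub>v (v + S *\<^sub>v v)"
    define v2 where "v2 = inverse 2 \<cdot>\<^sub>v (v - S *\<^sub>v v)"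
    have "S *\<^sub>v v1 = v1"
      using S v Sv inv[OF v] unfolding v1_def
      by (simp add: mult_mat_vec mult_add_distrib_mat_vec comm_add_vec[OF v Sv])
    moreover have "v1 \<in> carrier_vec n" using v Sv by (simp add: v1_def)
    ultimately have "v1 \<in> V.span B" by (simp add: Bs mat_kernel_minus_one[OF S])
    then have 1: "v1 \<in> V.span (B \<union> C)"
      using V.span_is_monotone[of B "B \<union> C"] by blast
    have "S *\<^sub>v v2 = inverse 2 \<cdot>\<^sub>v (S *\<^sub>v v - v)"
      using S v Sv inv[OF v] unfolding v2_def
      by (simp add: mult_mat_vec mult_minus_distrib_mat_vec)
    also have "\<dots> = - v2"
    proof -
      have "inverse 2 \<cdot>\<^sub>v (w - v) = - (inverse 2 \<cdot>\<^sub>v (v - w))" if "w \<in> carrier_vec n" for w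
        using v that by (intro eq_vecI) (simp_all add: right_diff_distrib diff_divide_distrib)
      then show ?thesis using Sv unfolding v2_def .
    qed
    finally have "S *\<^sub>v v2 = - v2" .
    moreover have "v2 \<in> carrier_vec n" using v Sv by (simp add: v2_def)
    ultimately have "v2 \<in> V.span C" by (simp add: Cs mat_kernel_plus_one[OF S])
    then have 2: "v2 \<in> V.span (B \<union> C)"
      using V.span_is_monotone[of C "B \<union> C"] by blast
    have "v = v1 + v2"
      unfolding v1_def v2_def using two v Sv by (rule vec_eq_half_sum_diff)
    then show "v \<in> V.span (B \<union> C)"
      using V.span_add1[OF _ 1 2] BC by simp
  qed
  then have sp: "V.span (B \<union> C) = carrier_vec n"
    using V.span_is_subset2[of "B \<union> C"] BC by auto
  \<comment> \<open>Extending \<open>B\<close> inside \<open>B \<union> C\<close> takes the place of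
    a proof that the eigenspaces meet trivially: what is added to \<open>B\<close> lies in
    \<open>C\<close>, and the size of \<open>U\<close> comes from the spanning property.\<close>
  obtain U where U: "maximal U (\<lambda>T. T \<subseteq> B \<union> C \<and> V.lin_indpt T)" "B \<subseteq> U" "finite U"
    using maximal_exists_superset[of "B \<union> C" "\<lambda>T. T \<subseteq> B \<union> C \<and> V.lin_indpt T" B] B(1) C(1) Bi
    by auto
  have Ui: "V.lin_indpt U" "U \<subseteq> B \<union> C" using U(1) by (auto simp: maximal_def)
  have cU: "card U = n"
  proof -
    have vs: "V.vs (carrier_vec n) = module_vec TYPE('a) n" by (simp add: module_vec_def)
    have "vectorspace.dim class_ring (V.vs (V.span (B \<union> C))) = card U"
      using BC B(1) C(1) by (intro V.dim_span[OF _ _ U(1)]) auto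
    then show ?thesis unfolding sp vs V.dim_is_n ..
  qed
  obtain us where us: "set us = B" "distinct us" using finite_distinct_list[OF B(1)] by auto
  obtain ws where ws: "set ws = U - B" "distinct ws"
    using finite_distinct_list[of "U - B"] U(3) by auto
  have cols: "cols (mat_of_cols n (us @ ws)) = us @ ws"
    using us ws BC Ui(2) by (intro cols_mat_of_cols) auto
  have sU: "set (us @ ws) = U" using us ws U(2) by auto
  have d: "distinct (us @ ws)" using us ws by auto
  have len: "length us + length ws = n"
    using distinct_card[OF d] cU sU by simp
  have "V.rank (mat_of_cols n (us @ ws)) = n"
    by (rule V.lin_indpt_full_rank) (use cols sU d Ui len in auto)
  then have "det (mat_of_cols n (us @ ws)) \<noteq> 0"
    using V.det_rank_iff[of "mat_of_cols n (us @ ws)"] len by (metis length_append mat_of_cols_carrier(1))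
  moreover have "length us = kernel_dim (S - 1\<^sub>m n)"
    using distinct_card[OF us(2)] us(1) E.Ker.dim_basis[OF B] by simp
  moreover have "set us \<subseteq> {v \<in> carrier_vec n. S *\<^sub>v v = v}"
    using us(1) Bk mat_kernel_minus_one[OF S] by simp
  moreover have "set ws \<subseteq> {v \<in> carrier_vec n. S *\<^sub>v v = - v}"
    using ws(1) Ui(2) Ck mat_kernel_plus_one[OF S] by auto
  ultimately show ?thesis using that len by blast
qed

text \<open>The matrix with an eigenbasis as columns conjugates \<open>S\<close> to a diagonal
  matrix with entries 1 and -1, and similar matrices share their characteristic polynomial.\<close>

lemma char_poly_involution:
  fixes S :: "'a::field mat"
  assumes S: "S \<in> carrier_mat n n" and two: "(2::'a) \<noteq> 0"
    and inv: "\<And>v. v \<in> carrier_vec n \<Longrightarrow> S *\<^sub>v (S *\<^sub>v v) = v"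
  shows "char_poly S = [:-1, 1:] ^ kernel_dim (S - 1\<^sub>m n) * [:1, 1:] ^ (n - kernel_dim (S - 1\<^sub>m n))"
proof -
  obtain us ws where len: "length us = kernel_dim (S - 1\<^sub>m n)" "length us + length ws = n"
    and us: "set us \<subseteq> {v \<in> carrier_vec n. S *\<^sub>v v = v}"
    and ws: "set ws \<subseteq> {v \<in> carrier_vec n. S *\<^sub>v v = - v}"
    and det: "det (mat_of_cols n (us @ ws)) \<noteq> 0"
    by (rule involution_eigenbasis[OF assms])
  define m where "m = length us"
  define P where "P = mat_of_cols n (us @ ws)"
  define D :: "'a mat" where "D = mat_diag n (\<lambda>i. if i < m then 1 else -1)"
  have P: "P \<in> carrier_mat n n" using len(2) by (simp add: P_def mat_of_cols_def)
  have D: "D \<in> carrier_mat n n" by (simp add: D_def)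
  have SP: "S * P = P * D"
  proof (rule eq_matI)
    fix r j assume "r < dim_row (P * D)" "j < dim_col (P * D)"
    then have r: "r < n" and j: "j < n" using P D by auto
    have "(us @ ws) ! j \<in> carrier_vec n"
      using j len(2) us ws nth_mem[of j "us @ ws"] by auto
    then have cj: "col P j = (us @ ws) ! j"
      unfolding P_def using j len(2) by (intro col_mat_of_cols) auto
    have "(us @ ws) ! j \<in> {v \<in> carrier_vec n. S *\<^sub>v v = (if j < m then 1 else -1) \<cdot>\<^sub>v v}"
    proof (cases "j < m")
      case True
      then have "us ! j \<in> {v \<in> carrier_vec n. S *\<^sub>v v = v}"
        using us nth_mem[of j us] unfolding m_def by blast
      then show ?thesis using True by (simp add: m_def nth_append)
    next
      case False
      then have "ws ! (j - m) \<in> set ws" using j len(2) by (auto simp: m_def)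
      \<comment> \<open>Writing negation as scaling treats both eigenvalues by one formula, matching
        the diagonal entries of \<open>D\<close>.\<close>
      moreover have "- v = (-1) \<cdot>\<^sub>v v" for v :: "'a vec" by auto
      ultimately show ?thesis using False ws by (auto simp: m_def nth_append)
    qed
    then have "S *\<^sub>v col P j = (if j < m then 1 else -1) \<cdot>\<^sub>v col P j"
      by (simp add: cj)
    moreover have "(S * P) $$ (r, j) = (S *\<^sub>v col P j) $ r"
      using S P r j by simp
    ultimately have "(S * P) $$ (r, j) = (if j < m then 1 else -1) * P $$ (r, j)"
      using r j P by simp
    then show "(S * P) $$ (r, j) = (P * D) $$ (r, j)"
      using r j P by (simp add: D_def mat_diag_mult_right[OF P])
  qed (use S P D in auto)
  obtain Q where Q: "Q \<in> carrier_mat n n" "P * Q = 1\<^sub>m n" "Q * P = 1\<^sub>m n"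
    using det_non_zero_imp_unit[OF P] det P_def
    by (auto simp: Units_def ring_mat_def)
  have "S = S * (P * Q)" using S Q by simp
  also have "\<dots> = P * D * Q"
    using assoc_mult_mat[OF S P Q(1)] by (simp add: SP)
  finally have "similar_mat S D"
    using S P D Q by (intro similar_matI[of _ _ P Q n]) auto
  then have "char_poly S = char_poly D" by (rule char_poly_similar)
  also have "\<dots> = (\<Prod>a\<leftarrow>diag_mat D. [:- a, 1:])"
    using D by (intro char_poly_upper_triangular) (auto simp: D_def mat_diag_def upper_triangular_def)
  also have "diag_mat D = replicate m 1 @ replicate (n - m) (-1)"
    using len by (intro nth_equalityI) (auto simp: diag_mat_def D_def mat_diag_def nth_append m_def)
  finally show ?thesis by (simp add: m_def len(1))
qed

text \<open>The exponent \<open>i\<close> can be recovered as the multiplicity of the root 1: the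
  factor \<open>[:1, 1:]\<close> takes the value 2 there, which is nonzero.\<close>

lemma order_char_poly_involution:
  assumes "(2::'a::field) \<noteq> 0"
  shows "order 1 ([:-1, 1:] ^ i * [:1, 1:] ^ j :: 'a poly) = i"
proof -
  have "order 1 ([:-1, 1:] ^ i * [:1, 1:] ^ j :: 'a poly) = order 1 ([:-1, 1:] ^ i :: 'a poly) + order 1 ([:1, 1:] ^ j :: 'a poly)"
    by (rule order_mult) auto
  also have "order 1 ([:1, 1:] ^ j :: 'a poly) = 0"
    using assms by (intro order_0I) (simp add: one_add_one)
  finally show ?thesis
    using order_power_n_n[of "1::'a" i] by simp
qed

section \<open>Coefficients of the characteristic polynomial as polynomial functions\<close>

lemma poly_funs_sum:
  assumes "\<And>a. a \<in> A \<Longrightarrow> f a \<in> poly_funs I"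
  shows "(\<lambda>x. \<Sum>a\<in>A. f a x) \<in> poly_funs I"
  using assms by (induction A rule: infinite_finite_induct) (auto intro: poly_funs.intros)

lemma coeff_mult_poly_funs:
  assumes "\<And>k. (\<lambda>x. coeff (p x) k) \<in> poly_funs I" "\<And>k. (\<lambda>x. coeff (q x) k) \<in> poly_funs I"
  shows "(\<lambda>x. coeff (p x * q x) k) \<in> poly_funs I"
  unfolding coeff_mult using assms by (intro poly_funs_sum poly_funs.mult)

lemma coeff_prod_poly_funs:
  assumes "\<And>a k. a \<in> A \<Longrightarrow> (\<lambda>x. coeff (p a x) k) \<in> poly_funs I"
  shows "(\<lambda>x. coeff (\<Prod>a\<in>A. p a x) k) \<in> poly_funs I"
  using assms
proof (induction A arbitrary: k rule: infinite_finite_induct)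
  case (insert a A)
  then show ?case by (auto intro!: coeff_mult_poly_funs)
qed (auto intro: poly_funs.const)

text \<open>In the Leibniz expansion of the characteristic determinant, each factor has coefficients
  that are polynomial functions of the point \<open>x\<close>, and this property survives finite
  sums and products.\<close>

lemma coeff_char_poly_poly_funs:
  assumes "\<And>i j. i < n \<Longrightarrow> j < n \<Longrightarrow> f i j \<in> poly_funs I"
  shows "(\<lambda>x. coeff (char_poly (mat n n (\<lambda>(i, j). f i j x))) k) \<in> poly_funs I"
proof -
  have "(\<lambda>x. coeff (\<Sum>p\<in>{p. p permutes {0..<n}}.
      signof p * (\<Prod>i = 0..<n. (if i = p i then [:0, 1:] else 0) + [:- f i (p i) x:])) k) \<in> poly_funs I"
    (is "?F \<in> _")
    unfolding coeff_sum
  proof (intro poly_funs_sum coeff_mult_poly_funs coeff_prod_poly_funs poly_funs.const)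
    fix p i k assume "p \<in> {p. p permutes {0..<n}}" "i \<in> {0..<n}"
    then have "f i (p i) \<in> poly_funs I"
      using permutes_in_image[of p "{0..<n}" i] by (intro assms) auto
    \<comment> \<open>The rules of \<open>poly_funs\<close> provide no negation, so it is expressed
      as a product with a constant.\<close>
    then have "(\<lambda>x. (-1) * f i (p i) x) \<in> poly_funs I"
      by (intro poly_funs.mult poly_funs.const)
    then have "(\<lambda>x. coeff [:- f i (p i) x:] k) \<in> poly_funs I"
      by (cases k) (auto intro: poly_funs.const)
    then show "(\<lambda>x. coeff ((if i = p i then [:0, 1:] else 0) + [:- f i (p i) x:]) k) \<in> poly_funs I"
      unfolding coeff_add by (intro poly_funs.add poly_funs.const)
  qed
  also have "?F = (\<lambda>x. coeff (char_poly (mat n n (\<lambda>(i, j). f i j x))) k)"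
    unfolding char_poly_defs
    by (subst det_def'[of _ n])
      (auto intro!: ext sum.cong prod.cong arg_cong2[where f = coeff] arg_cong2[where f = "(*)"]
        simp: permutes_in_image)
  finally show ?thesis .
qed

section \<open>Closedness of the strata\<close>

text \<open>The indices are transposed because \<open>Gamma i j\<close> is the coefficient of the
  \<open>j\<close>-th basis vector in the image of the \<open>i\<close>-th, whereas matrices act on
  column vectors.\<close>

definition sigma_mat :: "nat \<Rightarrow> (salg_coord \<Rightarrow> 'a) \<Rightarrow> 'a mat" where
  "sigma_mat n x = mat n n (\<lambda>(j, i). x (Gamma i j))"

lemma sigma_mat_carrier [simp]: "sigma_mat n x \<in> carrier_mat n n"
  by (simp add: sigma_mat_def)

lemma sigma_mat_mult_vec:
  fixes x :: "salg_coord \<Rightarrow> 'a::field"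
  assumes "v \<in> carrier_vec n"
  shows "sigma_mat n x *\<^sub>v v = salg_sigma n x v"
  using assms
  by (intro eq_vecI)
    (auto simp: sigma_mat_def salg_sigma_def scalar_prod_def lessThan_atLeast0 mult.commute intro!: sum.cong)

lemma salg_algebra_sel:
  "carrier (salg_algebra n x) = carrier_vec n" "add (salg_algebra n x) = (+)"
  "zero (salg_algebra n x) = 0\<^sub>v n" "module.smult (salg_algebra n x) = (\<cdot>\<^sub>v)"
  by (simp_all add: salg_algebra_def module_vec_def)

text \<open>The vectors fixed by the map are exactly the kernel of its matrix minus the
  identity.\<close>

lemma dim_even_part:
  fixes x :: "salg_coord \<Rightarrow> 'a::field"
  shows "vectorspace.dim (class_ring :: 'a ring) (even_part (salg_algebra n x) (salg_sigma n x))
    = kernel_dim (sigma_mat n x - 1\<^sub>m n)"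
proof -
  interpret kernel n n "sigma_mat n x - 1\<^sub>m n"
    by unfold_locales (simp add: minus_carrier_mat)
  have "vectorspace.dim class_ring (even_part (salg_algebra n x) (salg_sigma n x)) = dim"
    by (rule vectorspace_dim_cong[OF Ker.vectorspace_axioms])
      (auto simp: even_part_def salg_algebra_sel mat_kernel_minus_one sigma_mat_mult_vec module_vec_simps)
  then show ?thesis by simp
qed

lemma Salg_dim_iff_char_poly:
  fixes x :: "salg_coord \<Rightarrow> 'a::field"
  assumes "(2::'a) \<noteq> 0" and x: "x \<in> Salg n"
  shows "x \<in> Salg_dim n i \<longleftrightarrow> char_poly (sigma_mat n x) = [:-1, 1:] ^ i * [:1, 1:] ^ (n - i)"
proof -
  have "salg_sigma n x (salg_sigma n x v) = v" if "v \<in> carrier_vec n" for v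
    using x that by (simp add: Salg_def superalgebra_def salg_algebra_sel)
  then have "sigma_mat n x *\<^sub>v (sigma_mat n x *\<^sub>v v) = v" if "v \<in> carrier_vec n" for v
    using that by (simp add: sigma_mat_mult_vec salg_sigma_def)
  then have "char_poly (sigma_mat n x) = [:-1, 1:] ^ kernel_dim (sigma_mat n x - 1\<^sub>m n)
      * [:1, 1:] ^ (n - kernel_dim (sigma_mat n x - 1\<^sub>m n))"
    using assms(1) by (intro char_poly_involution) auto
  then show ?thesis
    \<comment> \<open>Comparing multiplicities of the root 1 forces the kernel dimension to be
      \<open>i\<close>. The multiplicity does not depend on the second exponent, so the truncated
      subtraction \<open>n - i\<close> does no harm when \<open>i\<close> exceeds
      \<open>n\<close>.\<close>
    using x order_char_poly_involution[OF assms(1)] unfolding Salg_dim_def dim_even_part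
    by (metis (mono_tags, lifting) mem_Collect_eq)
qed

lemma closedin_Salg_dim:
  assumes "(2::'a::field) \<noteq> 0"
  shows "closedin (Salg_top n) (Salg_dim n i :: (salg_coord \<Rightarrow> 'a) set)"
proof -
  define q :: "'a poly" where "q = [:-1, 1:] ^ i * [:1, 1:] ^ (n - i)"
  \<comment> \<open>One equation per coefficient index; together they say that the characteristic
    polynomial equals \<open>q\<close>.\<close>
  define F where "F = range (\<lambda>k x. coeff (char_poly (sigma_mat n x)) k + - coeff q k)"
  have "F \<subseteq> poly_funs (salg_coords n)"
    unfolding F_def sigma_mat_def
    by (intro image_subsetI poly_funs.add poly_funs.const coeff_char_poly_poly_funs poly_funs.coord)
      (simp add: salg_coords_def)
  then have "closedin (zariski (salg_coords n)) (zero_locus (salg_coords n) F)"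
    unfolding closedin_zariski by blast
  moreover have "Salg_dim n i = zero_locus (salg_coords n) F \<inter> Salg n"
  proof -
    have "x \<in> Salg_dim n i \<longleftrightarrow> x \<in> zero_locus (salg_coords n) F" if "x \<in> Salg n" for x
      using that
      by (auto simp: Salg_dim_iff_char_poly[OF assms that] zero_locus_def F_def q_def[symmetric] poly_eq_iff
          Salg_def)
    then show ?thesis by (auto simp: Salg_dim_def)
  qed
  ultimately show ?thesis
    unfolding Salg_top_def closedin_subtopology by blast
qed

theorem lemma2p7:
  fixes n :: nat
  assumes "CHAR('a::alg_closed_field) \<noteq> 2" and "n \<ge> 1"
  shows "(CHAR('a) > 0 \<and> n \<le> 2 * CHAR('a) \<longrightarrow>
            (\<forall>i\<in>{1..n}. closedin (Salg_top n) (Salg_dim n i :: (salg_coord \<Rightarrow> 'a) set))) \<and>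
         (CHAR('a) = 0 \<longrightarrow>
            (\<forall>i\<in>{1..n}. closedin (Salg_top n) (Salg_dim n i :: (salg_coord \<Rightarrow> 'a) set))) \<and>
         (n \<le> 6 \<longrightarrow>
            (\<forall>i\<in>{1..n}. closedin (Salg_top n) (Salg_dim n i :: (salg_coord \<Rightarrow> 'a) set)))"
proof -
  have "(2::'a) \<noteq> 0"
  proof
    assume "(2::'a) = 0"
    then have "of_nat 2 = (0::'a)" by simp
    then have "CHAR('a) dvd 2" by (simp only: of_nat_eq_0_iff_char_dvd)
    \<comment> \<open>A field cannot have characteristic 1, so the excluded value 2 is the only
      possibility left.\<close>
    then have "CHAR('a) = 1 \<or> CHAR('a) = 2"
      using two_is_prime_nat by (auto simp: prime_nat_iff)
    then show False using assms(1) by simp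
  qed
  then show ?thesis by (simp add: closedin_Salg_dim)
qed

end
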